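(* Let $f : (0,\infty) \to \mathbb{R}$ be a continuous function such that, for every $x > 0$, the limit $\lim_{n\to\infty} f(nx)$ exists in $[-\infty,\infty]$. Then the limit $\lim_{x\to\infty} f(x)$ exists in $[-\infty,\infty]$.
   Context: Here $n$ ranges over $\mathbb{N}=\{1,2,\ldots\}$ and $[-\infty,\infty] = \mathbb{R}\cup\{-\infty,\infty\}$ denotes the extended real line. *)

theory Defs
  imports "HOL-Analysis.Analysis"
begin

end

theory Submission
  imports Defs
begin

text \<open>
  If \<open>f\<close> has no limit at infinity, there are reals \<open>a < b\<close> such that the open sets
  \<open>{f < a}\<close> and \<open>{f > b}\<close> are both unbounded above. For an unbounded open set \<open>U\<close>, the points
  \<open>x > 0\<close> with infinitely many multiples \<open>n x\<close> in \<open>U\<close> form a dense \<open>G\<^sub>\<delta>\<close> set: it is the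
  intersection over \<open>N\<close> of the open sets of those \<open>x\<close> that have a multiple \<open>n x \<in> U\<close> with
  \<open>n \<ge> N\<close>, and these are dense because the dilates \<open>(n c, n d)\<close> of an interval
  overlap for large \<open>n\<close> and so cover a half-line (lemma \<open>dilate_meets_unbounded\<close>). By the Baire
  category theorem one single \<open>x\<close> serves both sets (lemma
  \<open>common_point_infinitely_many_multiples\<close>). Then \<open>f (n x)\<close> is infinitely often below \<open>a\<close> and
  infinitely often above \<open>b\<close>, so it cannot converge in the extended reals.
\<close>

text \<open>The admissible \<open>n\<close> are those between \<open>y / d\<close> and \<open>y / c\<close>, an interval whose length
  grows linearly with \<open>y\<close>.\<close>
lemma dilate_meets_unbounded:
  fixes U :: "real set" and c d :: real
  assumes unb: "\<And>B. \<exists>y\<in>U. B \<le> y" and "0 < c" "c < d"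
  shows "\<exists>n\<ge>N. \<exists>y\<in>U. real n * c < y \<and> y < real n * d"
proof -
  have gap: "0 < 1 / c - 1 / d"
    using assms(2,3) by (simp add: frac_less2)
  obtain y where y: "y \<in> U" "max (real N * d) (2 / (1 / c - 1 / d)) \<le> y"
    using unb by blast
  have "2 \<le> y * (1 / c - 1 / d)"
    using y(2) gap by (simp add: pos_divide_le_eq)
  then have long: "y / d + 2 \<le> y / c"
    by (simp add: algebra_simps)
  have low: "real N \<le> y / d"
    using y(2) assms(2,3) by (simp add: pos_le_divide_eq)
  define n where "n = nat (\<lfloor>y / d\<rfloor> + 1)"
  have n: "y / d < real n" "real n \<le> y / d + 1"
    using low unfolding n_def by linarith+
  have "N \<le> n"
    using low n(1) by linarith
  moreover have "real n * c < y"
    using n(2) long assms(2) by (simp add: pos_less_divide_eq [symmetric])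
  moreover have "y < real n * d"
    using n(1) assms(2,3) by (simp add: pos_divide_less_eq)
  ultimately show ?thesis
    using y(1) by blast
qed

text \<open>Writing the points as \<open>exp t\<close> turns the positive half-line into the whole
  real line, where the Baire category theorem applies directly.\<close>
lemma dense_exp_multiples:
  fixes U :: "real set"
  assumes "\<And>B. \<exists>y\<in>U. B \<le> y"
  shows "closure {t. \<exists>n\<ge>N. real n * exp t \<in> U} = UNIV" (is "closure ?T = UNIV")
proof -
  have "\<exists>s\<in>?T. dist s t < e" if "e > 0" for t e :: real
  proof -
    obtain n y where ny: "N \<le> n" "y \<in> U" "real n * exp t < y" "y < real n * exp (t + e)"
      using dilate_meets_unbounded [OF assms, of "exp t" "exp (t + e)" N] \<open>e > 0\<close> by auto
    have "n \<noteq> 0"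
      using ny(3,4) by (intro notI) simp
    define s where "s = ln (y / real n)"
    have bounds: "exp t < y / real n" "y / real n < exp (t + e)"
      using ny(3,4) \<open>n \<noteq> 0\<close> by (simp_all add: field_simps)
    have exp_s: "exp s = y / real n"
      unfolding s_def using bounds(1) exp_gt_zero [of t] by (intro exp_ln) linarith
    then have "t < s" "s < t + e"
      using bounds exp_less_cancel_iff by metis+
    moreover have "s \<in> ?T"
      using ny(1,2) \<open>n \<noteq> 0\<close> exp_s by auto
    ultimately show ?thesis
      by (intro bexI [of _ s]) (auto simp: dist_real_def)
  qed
  then show ?thesis
    by (auto simp: closure_approachable)
qed

lemma open_exp_multiples:
  fixes U :: "real set"
  assumes "open U"
  shows "open {t. \<exists>n\<ge>N. real n * exp t \<in> U}"
proof -
  have "open ((\<lambda>t. real n * exp t) -` U)" for n :: nat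
    by (intro open_vimage assms continuous_intros)
  then have "open (\<Union>n\<in>{N..}. (\<lambda>t. real n * exp t) -` U)"
    by blast
  moreover have "(\<Union>n\<in>{N..}. (\<lambda>t. real n * exp t) -` U) = {t. \<exists>n\<ge>N. real n * exp t \<in> U}"
    by auto
  ultimately show ?thesis
    by simp
qed

lemma common_point_infinitely_many_multiples:
  fixes U V :: "real set"
  assumes "open U" "\<And>B. \<exists>y\<in>U. B \<le> y" "open V" "\<And>B. \<exists>y\<in>V. B \<le> y"
  shows "\<exists>x>0. (\<exists>\<^sub>F n in sequentially. real n * x \<in> U) \<and> (\<exists>\<^sub>F n in sequentially. real n * x \<in> V)"
proof -
  define T where "T W N = {t. \<exists>n\<ge>N. real n * exp t \<in> W}" for W :: "real set" and N :: nat
  have "UNIV \<subseteq> closure (\<Inter> (range (T U) \<union> range (T V)))"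
  proof (rule Baire)
    fix G assume "G \<in> range (T U) \<union> range (T V)"
    then show "openin (top_of_set UNIV) G \<and> UNIV \<subseteq> closure G"
      using assms open_exp_multiples dense_exp_multiples unfolding T_def by auto
  qed auto
  then have "\<Inter> (range (T U) \<union> range (T V)) \<noteq> {}"
    by force
  then obtain t where "\<And>N. t \<in> T U N" "\<And>N. t \<in> T V N"
    by blast
  then show ?thesis
    unfolding T_def frequently_sequentially by (intro exI [of _ "exp t"]) auto
qed

theorem mainTheorem2:
  fixes f :: "real \<Rightarrow> real"
  assumes "continuous_on {0<..} f"
    and "\<And>x::real. x > 0 \<Longrightarrow>
           \<exists>L::ereal. (\<lambda>n::nat. ereal (f (real n * x))) \<longlonglongrightarrow> L"
  shows "\<exists>L::ereal. ((\<lambda>x::real. ereal (f x)) \<longlongrightarrow> L) at_top"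
proof (rule ccontr)
  let ?F = "\<lambda>x. ereal (f x)"
  assume no_lim: "\<not> ?thesis"
  have "Liminf at_top ?F \<noteq> Limsup at_top ?F"
    using no_lim lim_imp_Liminf Liminf_eq_Limsup [of at_top ?F] by auto
  moreover have "Liminf at_top ?F \<le> Limsup at_top ?F"
    by (rule Liminf_le_Limsup) simp
  ultimately have "Liminf at_top ?F < Limsup at_top ?F"
    by simp
  then obtain b where b: "Liminf at_top ?F < ereal b" "ereal b < Limsup at_top ?F"
    using ereal_dense2 by blast
  then obtain a where a: "Liminf at_top ?F < ereal a" "ereal a < ereal b"
    using ereal_dense2 by blast
  have below: "\<exists>\<^sub>F x in at_top. f x < a"
    using a(1) Liminf_bounded [of "ereal a" ?F at_top]
    by (auto simp: frequently_def not_less)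
  have above: "\<exists>\<^sub>F x in at_top. b < f x"
    using b(2) Limsup_bounded [of ?F "ereal b" at_top]
    by (auto simp: frequently_def not_less)
  have unb: "\<exists>y\<in>{0<..} \<inter> f -` S. B \<le> y" if "\<exists>\<^sub>F x in at_top. f x \<in> S" for S B
  proof -
    have "\<exists>\<^sub>F x in at_top. max 1 B \<le> x \<and> f x \<in> S"
      using that eventually_ge_at_top by (rule frequently_eventually_conj)
    then show ?thesis
      by (auto dest!: frequently_ex)
  qed
  have op: "open ({0<..} \<inter> f -` S)" if "open S" for S
    using assms(1) open_greaterThan that by (rule continuous_open_preimage)
  let ?U = "{0<..} \<inter> f -` {..<a}" and ?V = "{0<..} \<inter> f -` {b<..}"
  have "\<exists>y\<in>?U. B \<le> y" for B
    by (rule unb) (simp add: below)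
  moreover have "\<exists>y\<in>?V. B \<le> y" for B
    by (rule unb) (simp add: above)
  ultimately obtain x where "x > 0"
    and freq: "\<exists>\<^sub>F n in sequentially. real n * x \<in> ?U" "\<exists>\<^sub>F n in sequentially. real n * x \<in> ?V"
    using common_point_infinitely_many_multiples [OF op [OF open_lessThan] _ op [OF open_greaterThan]]
    by metis
  obtain L where L: "(\<lambda>n. ereal (f (real n * x))) \<longlonglongrightarrow> L"
    using assms(2) \<open>x > 0\<close> by blast
  have "L \<le> ereal a"
  proof (rule ccontr)
    assume "\<not> L \<le> ereal a"
    then have "\<forall>\<^sub>F n in sequentially. ereal a < ereal (f (real n * x))"
      using order_tendstoD(1) [OF L, of "ereal a"] by simp
    then show False
      using frequently_ex [OF frequently_eventually_conj [OF freq(1)]] by fastforce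
  qed
  moreover have "ereal b \<le> L"
  proof (rule ccontr)
    assume "\<not> ereal b \<le> L"
    then have "\<forall>\<^sub>F n in sequentially. ereal (f (real n * x)) < ereal b"
      using order_tendstoD(2) [OF L, of "ereal b"] by simp
    then show False
      using frequently_ex [OF frequently_eventually_conj [OF freq(2)]] by fastforce
  qed
  ultimately show False
    using a(2) by (metis leD order_trans)
qed

end
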